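(* Let $F$ be a function field of genus $g$ over $\mathbb{F}_q$ of characteristic $p$, let $P_1,\dots,P_n$ be pairwise distinct rational places of $F$, $D=P_1+\cdots+P_n$, and let $G$ be a divisor with support disjoint from that of $D$. Let $d^*=n-\deg G$ be the designed minimum distance of $C_L(D,G)$ and let $e\ge 0$ be an integer. Then the inseparable Guruswami–Sudan list-decoder with $s=\ell=1$ and exponent $e$ is a bounded distance decoder for the AG code $C_L(D,G)$ with decoding radius at least \[\frac{d^*}{2}-\frac{1+g}{2p^e}.\] In particular, choosing $e=\lceil\log_p(1+g)\rceil$, one obtains a decoder with decoding radius $(d^*-1)/2$.
   Context: $F$ has full constant field $\mathbb{F}_q$. For a divisor $A$, $L(A)=\{h\in F\setminus\{0\}\mid (h)+A\ge 0\}\cup\{0\}$. The AG code is $C_L(D,G)=\{(f(P_1),\dots,f(P_n))\mid f\in L(G)\}\subseteq\mathbb{F}_q^n$. Multiplicity: for a rational place $P$, $r\in\mathbb{F}_q$ and $Q(z)\in F[z]$, $(P,r)$ is a zero of $Q$ with multiplicity at least $m$ if, for a local parameter $\phi$ of $P$, $Q(z)=\sum_{a,b\ge0,\ a+b\ge m}c_{a,b}\phi^a(z-r)^b$ with $c_{a,b}\in\mathbb{F}_q$ (power series expansion at $P$). Inseparable Guruswami–Sudan list-decoder with $s=\ell=1$ and exponent $e$, for a target number of errors $\tau$ (an integer, $0\le\tau\le n$): fix any divisor $A$ with support disjoint from that of $D$ and $\deg A=p^e(n-\tau)-1$. On input $\mathbf r=(r_1,\dots,r_n)\in\mathbb{F}_q^n$,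 find a nonzero polynomial $Q(z)=Q_1z^{p^e}+Q_0\in F[z]$ with $Q_0\in L(A)$, $Q_1\in L(A-p^eG)$ and such that each $(P_i,r_i)$, $i=1,\dots,n$, is a zero of $Q(z)$ with multiplicity at least $p^e$. If no such $Q$ exists, declare failure; otherwise return the $f\in L(G)$ (if any; otherwise declare failure) with $Q(f)=0$ and with $(f(P_1),\dots,f(P_n))$ at Hamming distance at most $\tau$ from $\mathbf r$. The decoder is a bounded distance decoder with decoding radius at least a real number $X$ if for every integer $\tau$ with $0\le\tau\le n$ and $\tau\le X$, and every $\mathbf r\in\mathbb{F}_q^n$, there is at most one $f\in L(G)$ whose codeword has Hamming distance at most $\tau$ from $\mathbf r$, and the decoder with target $\tau$ (for any admissible choice of $A$ and $Q$) returns that $f$ if it exists and declares failure otherwise. *)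

theory Defs
  imports
    "HOL-Library.FuncSet"
    "HOL-Library.Poly_Mapping"
    "HOL-Computational_Algebra.Computational_Algebra"
begin

section \<open>Function fields of one variable\<close>

text \<open>
  The constant field \<open>\<bbbF>\<^sub>q\<close> is a finite field type \<open>'k\<close>, the function field is a field type \<open>'f\<close>, and
  \<open>\<iota> :: 'k \<Rightarrow> 'f\<close> is the inclusion of the constants.
\<close>

definition field_embedding :: "('k::field \<Rightarrow> 'f::field) \<Rightarrow> bool" where
  "field_embedding \<iota> \<longleftrightarrow>
     \<iota> 1 = 1 \<and> (\<forall>a b. \<iota> (a + b) = \<iota> a + \<iota> b) \<and> (\<forall>a b. \<iota> (a * b) = \<iota> a * \<iota> b)"

definition algebraic_over :: "('k::field \<Rightarrow> 'f::field) \<Rightarrow> 'f \<Rightarrow> bool" where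
  "algebraic_over \<iota> x \<longleftrightarrow> (\<exists>p. p \<noteq> 0 \<and> poly (map_poly \<iota> p) x = 0)"

definition simple_extension :: "('k::field \<Rightarrow> 'f::field) \<Rightarrow> 'f \<Rightarrow> 'f set" where
  "simple_extension \<iota> x =
     {poly (map_poly \<iota> a) x / poly (map_poly \<iota> b) x | a b. poly (map_poly \<iota> b) x \<noteq> 0}"

definition finite_over :: "'f::field set \<Rightarrow> bool" where
  "finite_over E \<longleftrightarrow> (\<exists>B. finite B \<and> (\<forall>y. \<exists>c. (\<forall>b\<in>B. c b \<in> E) \<and> y = (\<Sum>b\<in>B. c b * b)))"

definition function_field :: "('k::field \<Rightarrow> 'f::field) \<Rightarrow> bool" where
  "function_field \<iota> \<longleftrightarrow>
     field_embedding \<iota> \<and> (\<exists>x. \<not> algebraic_over \<iota> x \<and> finite_over (simple_extension \<iota> x))"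

definition full_constant_field :: "('k::field \<Rightarrow> 'f::field) \<Rightarrow> bool" where
  "full_constant_field \<iota> \<longleftrightarrow> (\<forall>x. algebraic_over \<iota> x \<longrightarrow> x \<in> range \<iota>)"


section \<open>Places\<close>

text \<open>
  A place \<open>P\<close> is represented by its normalized discrete valuation \<open>v\<^sub>P\<close>, which is written simply as
  \<open>P\<close>.  The value \<open>v\<^sub>P(0) = \<infinity>\<close> is not available in \<^typ>\<open>int\<close>; the dummy value \<open>P 0 = 0\<close> makes the
  representation unique, and \<open>ord_ge P x k\<close> is the relation \<open>v\<^sub>P(x) \<ge> k\<close> with the correct meaning
  at \<open>x = 0\<close>.
\<close>

type_synonym 'f place = "'f \<Rightarrow> int"

definition places :: "('k::field \<Rightarrow> 'f::field) \<Rightarrow> 'f place set" where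
  "places \<iota> = {P. P 0 = 0 \<and>
     (\<forall>x y. x \<noteq> 0 \<longrightarrow> y \<noteq> 0 \<longrightarrow> P (x * y) = P x + P y) \<and>
     (\<forall>x y. x \<noteq> 0 \<longrightarrow> y \<noteq> 0 \<longrightarrow> x + y \<noteq> 0 \<longrightarrow> P (x + y) \<ge> min (P x) (P y)) \<and>
     (\<forall>c. c \<noteq> 0 \<longrightarrow> P (\<iota> c) = 0) \<and>
     (\<exists>t. t \<noteq> 0 \<and> P t = 1)}"

definition ord_ge :: "'f::field place \<Rightarrow> 'f \<Rightarrow> int \<Rightarrow> bool" where
  "ord_ge P x k \<longleftrightarrow> x = 0 \<or> P x \<ge> k"

definition local_parameter :: "'f::field place \<Rightarrow> 'f \<Rightarrow> bool" where
  "local_parameter P \<phi> \<longleftrightarrow> \<phi> \<noteq> 0 \<and> P \<phi> = 1"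

text \<open>
  The valuation ring of \<open>P\<close> is \<open>{z. ord_ge P z 0}\<close> and its maximal ideal is \<open>{z. ord_ge P z 1}\<close>.
  A \<open>residue_basis\<close> is a finite set of representatives of a basis, over the constants, of the
  quotient of the two, i.e. of the residue class field.
\<close>

definition residue_basis :: "('k::field \<Rightarrow> 'f::field) \<Rightarrow> 'f place \<Rightarrow> 'f set \<Rightarrow> bool" where
  "residue_basis \<iota> P B \<longleftrightarrow> finite B \<and> (\<forall>b\<in>B. ord_ge P b 0) \<and>
     (\<forall>z. ord_ge P z 0 \<longrightarrow> (\<exists>!c. c \<in> B \<rightarrow>\<^sub>E UNIV \<and> ord_ge P (z - (\<Sum>b\<in>B. \<iota> (c b) * b)) 1))"

text \<open>
  The degree of a place is the dimension of its residue class field over the constants.  As for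
  the library's \<open>dim\<close>, infinite dimension would give 0; this does not occur in a function field.
\<close>

definition place_degree :: "('k::field \<Rightarrow> 'f::field) \<Rightarrow> 'f place \<Rightarrow> nat" where
  "place_degree \<iota> P =
     (if \<exists>B. residue_basis \<iota> P B then card (SOME B. residue_basis \<iota> P B) else 0)"

definition rational_place :: "('k::field \<Rightarrow> 'f::field) \<Rightarrow> 'f place \<Rightarrow> bool" where
  "rational_place \<iota> P \<longleftrightarrow> P \<in> places \<iota> \<and> place_degree \<iota> P = 1"

text \<open>The value \<open>x(P)\<close> at a rational place \<open>P\<close> which is not a pole of \<open>x\<close>.\<close>

definition place_eval :: "('k::field \<Rightarrow> 'f::field) \<Rightarrow> 'f place \<Rightarrow> 'f \<Rightarrow> 'k" where
  "place_eval \<iota> P x = (THE c. ord_ge P (x - \<iota> c) 1)"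


section \<open>Divisors, Riemann--Roch spaces and the genus\<close>

type_synonym 'f divisor = "'f place \<Rightarrow>\<^sub>0 int"

definition divisors :: "('k::field \<Rightarrow> 'f::field) \<Rightarrow> 'f divisor set" where
  "divisors \<iota> = {A. Poly_Mapping.keys A \<subseteq> places \<iota>}"

definition divisor_degree :: "('k::field \<Rightarrow> 'f::field) \<Rightarrow> 'f divisor \<Rightarrow> int" where
  "divisor_degree \<iota> A =
     (\<Sum>P\<in>Poly_Mapping.keys A. Poly_Mapping.lookup A P * int (place_degree \<iota> P))"

definition riemann_roch_space :: "('k::field \<Rightarrow> 'f::field) \<Rightarrow> 'f divisor \<Rightarrow> 'f set" where
  "riemann_roch_space \<iota> A =
     {h. h \<noteq> 0 \<and> (\<forall>P\<in>places \<iota>. P h + Poly_Mapping.lookup A P \<ge> 0)} \<union> {0}"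

definition rr_dim :: "('k::field \<Rightarrow> 'f::field) \<Rightarrow> 'f divisor \<Rightarrow> nat" where
  "rr_dim \<iota> A = vector_space.dim (\<lambda>c x. \<iota> c * x) (riemann_roch_space \<iota> A)"

text \<open>
  The genus is \<open>max {deg A - dim L(A) + 1 | A a divisor}\<close>.  It is given as a predicate since this
  maximum of an infinite set exists, in a function field, only by Riemann's theorem.
\<close>

definition has_genus :: "('k::field \<Rightarrow> 'f::field) \<Rightarrow> nat \<Rightarrow> bool" where
  "has_genus \<iota> g \<longleftrightarrow>
     (\<exists>A\<in>divisors \<iota>. divisor_degree \<iota> A - int (rr_dim \<iota> A) + 1 = int g) \<and>
     (\<forall>A\<in>divisors \<iota>. divisor_degree \<iota> A - int (rr_dim \<iota> A) + 1 \<le> int g)"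


section \<open>AG codes\<close>

text \<open>
  The places \<open>P\<^sub>1, \<dots>, P\<^sub>n\<close> are the entries of a list \<open>Ps\<close>; words in \<open>\<bbbF>\<^sub>q\<^sup>n\<close> are lists of length \<open>n\<close>.
  The AG code is the image of \<open>riemann_roch_space \<iota> G\<close> under \<open>codeword \<iota> Ps\<close>.
\<close>

definition evaluation_divisor :: "'f place list \<Rightarrow> 'f divisor" where
  "evaluation_divisor Ps = (\<Sum>P\<leftarrow>Ps. frag_of P)"

definition codeword :: "('k::field \<Rightarrow> 'f::field) \<Rightarrow> 'f place list \<Rightarrow> 'f \<Rightarrow> 'k list" where
  "codeword \<iota> Ps f = map (\<lambda>P. place_eval \<iota> P f) Ps"

definition designed_distance ::
  "('k::field \<Rightarrow> 'f::field) \<Rightarrow> 'f place list \<Rightarrow> 'f divisor \<Rightarrow> int" where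
  "designed_distance \<iota> Ps G = int (length Ps) - divisor_degree \<iota> G"

definition hamming_dist :: "'a list \<Rightarrow> 'a list \<Rightarrow> nat" where
  "hamming_dist xs ys = card {i. i < length xs \<and> xs ! i \<noteq> ys ! i}"


section \<open>The inseparable Guruswami--Sudan decoder with $s = \ell = 1$\<close>

text \<open>\<open>x = \<Sum>\<^sub>a c\<^sub>a \<phi>\<^sup>a\<close> in the completion at \<open>P\<close>.\<close>

definition power_series_at ::
  "('k::field \<Rightarrow> 'f::field) \<Rightarrow> 'f place \<Rightarrow> 'f \<Rightarrow> 'f \<Rightarrow> (nat \<Rightarrow> 'k) \<Rightarrow> bool" where
  "power_series_at \<iota> P \<phi> x c \<longleftrightarrow> (\<forall>N. ord_ge P (x - (\<Sum>a<N. \<iota> (c a) * \<phi> ^ a)) (int N))"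

text \<open>
  \<open>Q(z) = \<Sum>\<^sub>a\<^sub>,\<^sub>b c\<^sub>a\<^sub>,\<^sub>b \<phi>\<^sup>a (z - r)\<^sup>b\<close> with \<open>c\<^sub>a\<^sub>,\<^sub>b = 0\<close> for \<open>a + b < m\<close>: as \<open>Q\<close> is a polynomial, only
  \<open>b \<le> deg Q\<close> occur, and the coefficient \<open>h b\<close> of \<open>(z - r)\<^sup>b\<close> is the series \<open>\<Sum>\<^sub>a c\<^sub>a\<^sub>,\<^sub>b \<phi>\<^sup>a\<close>.
\<close>

definition zero_of_mult_ge ::
  "('k::field \<Rightarrow> 'f::field) \<Rightarrow> 'f place \<Rightarrow> 'k \<Rightarrow> 'f poly \<Rightarrow> nat \<Rightarrow> bool" where
  "zero_of_mult_ge \<iota> P r Q m \<longleftrightarrow>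
     (\<exists>\<phi> h c. local_parameter P \<phi> \<and>
        Q = (\<Sum>b\<le>degree Q. Polynomial.smult (h b) ([:- \<iota> r, 1:] ^ b)) \<and>
        (\<forall>b\<le>degree Q. power_series_at \<iota> P \<phi> (h b) (\<lambda>a. c a b)) \<and>
        (\<forall>a b. a + b < m \<longrightarrow> c a b = 0))"

definition decoder_divisor ::
  "('k::field \<Rightarrow> 'f::field) \<Rightarrow> 'f place list \<Rightarrow> nat \<Rightarrow> nat \<Rightarrow> 'f divisor \<Rightarrow> bool" where
  "decoder_divisor \<iota> Ps e \<tau> A \<longleftrightarrow>
     A \<in> divisors \<iota> \<and>
     Poly_Mapping.keys A \<inter> Poly_Mapping.keys (evaluation_divisor Ps) = {} \<and>
     divisor_degree \<iota> A = int (CHAR('k) ^ e) * (int (length Ps) - int \<tau>) - 1"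

definition interpolation_poly ::
  "('k::field \<Rightarrow> 'f::field) \<Rightarrow> 'f place list \<Rightarrow> 'f divisor \<Rightarrow> nat \<Rightarrow> 'f divisor \<Rightarrow>
     'k list \<Rightarrow> 'f poly \<Rightarrow> bool" where
  "interpolation_poly \<iota> Ps G e A r Q \<longleftrightarrow>
     Q \<noteq> 0 \<and>
     (\<exists>Q0 Q1. Q0 \<in> riemann_roch_space \<iota> A \<and>
        Q1 \<in> riemann_roch_space \<iota> (A - frag_cmul (int (CHAR('k) ^ e)) G) \<and>
        Q = Polynomial.monom Q1 (CHAR('k) ^ e) + [:Q0:]) \<and>
     (\<forall>i<length Ps. zero_of_mult_ge \<iota> (Ps ! i) (r ! i) Q (CHAR('k) ^ e))"

text \<open>
  The decoder leaves the choice of \<open>A\<close> and \<open>Q\<close> open, so it is a relation: \<open>gs_decoder \<dots> \<tau> r res\<close>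
  says that \<open>res\<close> is a possible result for the target number \<open>\<tau>\<close> of errors and the received word
  \<open>r\<close>, where \<^const>\<open>None\<close> stands for a declared failure.
\<close>

definition gs_decoder ::
  "('k::field \<Rightarrow> 'f::field) \<Rightarrow> 'f place list \<Rightarrow> 'f divisor \<Rightarrow> nat \<Rightarrow>
     nat \<Rightarrow> 'k list \<Rightarrow> 'f option \<Rightarrow> bool" where
  "gs_decoder \<iota> Ps G e \<tau> r res \<longleftrightarrow>
     (\<exists>A. decoder_divisor \<iota> Ps e \<tau> A \<and>
       (if \<exists>Q. interpolation_poly \<iota> Ps G e A r Q
        then \<exists>Q. interpolation_poly \<iota> Ps G e A r Q \<and>
          (let S = {f \<in> riemann_roch_space \<iota> G.
                      poly Q f = 0 \<and> hamming_dist (codeword \<iota> Ps f) r \<le> \<tau>}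
           in if S = {} then res = None else (\<exists>f\<in>S. res = Some f))
        else res = None))"

text \<open>
  The decoder \<open>dec\<close> (a relation as above) is a bounded distance decoder for the AG code of
  \<open>Ps\<close> and \<open>G\<close> with decoding radius at least \<open>X\<close>; it returns messages \<open>f \<in> L(G)\<close> rather than
  codewords.
\<close>

definition bounded_distance_decoder ::
  "('k::field \<Rightarrow> 'f::field) \<Rightarrow> 'f place list \<Rightarrow> 'f divisor \<Rightarrow>
     (nat \<Rightarrow> 'k list \<Rightarrow> 'f option \<Rightarrow> bool) \<Rightarrow> real \<Rightarrow> bool" where
  "bounded_distance_decoder \<iota> Ps G dec X \<longleftrightarrow>
     (\<forall>\<tau> r. \<tau> \<le> length Ps \<longrightarrow> real \<tau> \<le> X \<longrightarrow> length r = length Ps \<longrightarrow>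
        (let S = {f \<in> riemann_roch_space \<iota> G. hamming_dist (codeword \<iota> Ps f) r \<le> \<tau>}
         in (\<forall>f\<in>S. \<forall>f'\<in>S. f = f') \<and>
            (\<forall>res. dec \<tau> r res \<longrightarrow>
               (\<forall>f\<in>S. res = Some f) \<and> (S = {} \<longrightarrow> res = None))))"

end

theory Submission
  imports Defs
begin

text \<open>
  Let \<open>q = p\<^sup>e\<close>.  If \<open>f\<close> is a message within distance \<open>\<tau>\<close> of the received word and \<open>E\<close> is the sum of
  the places in error, then \<open>deg (A - q G - q E) \<ge> q (d\<^sup>* - 2 \<tau>) - 1 \<ge> g\<close>, so the Riemann--Roch space
  of this divisor has a nonzero element \<open>Q\<^sub>1\<close>, and \<open>Q\<^sub>1 (z\<^sup>q - f\<^sup>q)\<close> is an interpolation polynomial.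
  Conversely, for every interpolation polynomial \<open>Q\<close> the value \<open>Q(f)\<close> lies in \<open>L(A)\<close> and vanishes to
  order \<open>q\<close> at the at least \<open>n - \<tau>\<close> places without error, hence is zero, as \<open>deg A < q (n - \<tau>)\<close>.
\<close>

section \<open>Embeddings and characteristic\<close>

lemma field_embedding_zero: "field_embedding \<iota> \<Longrightarrow> \<iota> 0 = 0"
  unfolding field_embedding_def by (metis add_cancel_left_left)

lemma field_embedding_minus: "field_embedding \<iota> \<Longrightarrow> \<iota> (- a) = - \<iota> a"
  using field_embedding_zero[of \<iota>] unfolding field_embedding_def
  by (metis add.right_inverse minus_unique)

lemma field_embedding_diff: "field_embedding \<iota> \<Longrightarrow> \<iota> (a - b) = \<iota> a - \<iota> b"
  using field_embedding_minus[of \<iota> b] unfolding field_embedding_def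
  by (metis add_uminus_conv_diff)

lemma field_embedding_eq_0_iff: "field_embedding \<iota> \<Longrightarrow> \<iota> a = 0 \<longleftrightarrow> a = 0"
  using field_embedding_zero[of \<iota>] unfolding field_embedding_def
  by (metis field_class.field_inverse mult_zero_right zero_neq_one)

lemma field_embedding_of_nat: "field_embedding \<iota> \<Longrightarrow> \<iota> (of_nat n) = of_nat n"
  by (induction n) (simp_all add: field_embedding_zero, simp add: field_embedding_def)

text \<open>The decoder takes its exponent from the constants, whereas the Frobenius identity is
  applied in \<open>'f\<close>.\<close>

lemma field_embedding_CHAR:
  fixes \<iota> :: "'k::field \<Rightarrow> 'f::field"
  assumes "field_embedding \<iota>"
  shows "CHAR('f) = CHAR('k)"
proof (rule CHAR_eqI)
  show "of_nat CHAR('k) = (0::'f)"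
    using field_embedding_of_nat[OF assms, of "CHAR('k)"] field_embedding_zero[OF assms] by simp
next
  fix n assume "of_nat n = (0::'f)"
  then have "of_nat n = (0::'k)"
    using field_embedding_of_nat[OF assms] field_embedding_eq_0_iff[OF assms] by metis
  then show "CHAR('k) dvd n"
    by (simp add: of_nat_eq_0_iff_char_dvd)
qed

text \<open>Freshman's dream for the sum \<open>(x - y) + y\<close>, so that no sign
  \<open>(-1) ^ q\<close> has to be discussed.\<close>

lemma prime_char_power_diff:
  fixes x y :: "'a::comm_ring_1"
  assumes "prime CHAR('a)"
  shows "(x - y) ^ CHAR('a) ^ e = x ^ CHAR('a) ^ e - y ^ CHAR('a) ^ e"
  using freshmans_dream'[OF assms refl, of "x - y" y e] by (simp add: algebra_simps)


section \<open>Valuations and expansions\<close>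

lemma ord_ge_0 [simp]: "ord_ge P 0 k"
  by (simp add: ord_ge_def)

lemma ord_ge_mono: "ord_ge P x k \<Longrightarrow> l \<le> k \<Longrightarrow> ord_ge P x l"
  by (auto simp: ord_ge_def)

section \<open>Rules for orders at a single place\<close>

locale constants_place =
  fixes \<iota> :: "'k::field \<Rightarrow> 'f::field" and P :: "'f place"
  assumes emb: "field_embedding \<iota>" and place: "P \<in> places \<iota>"
begin

lemma place_mult: "x \<noteq> 0 \<Longrightarrow> y \<noteq> 0 \<Longrightarrow> P (x * y) = P x + P y"
  using place by (simp add: places_def)

lemma place_const: "c \<noteq> 0 \<Longrightarrow> P (\<iota> c) = 0"
  using place by (simp add: places_def)

lemma place_1: "P 1 = 0"
  using place_mult[of 1 1] by simp

lemma place_power: "x \<noteq> 0 \<Longrightarrow> P (x ^ n) = int n * P x"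
  by (induction n) (auto simp: place_1 place_mult algebra_simps)

lemma ord_ge_mult: "ord_ge P x k \<Longrightarrow> ord_ge P y l \<Longrightarrow> ord_ge P (x * y) (k + l)"
  by (cases "x = 0 \<or> y = 0") (auto simp: ord_ge_def place_mult)

lemma ord_ge_power: "ord_ge P x k \<Longrightarrow> ord_ge P (x ^ n) (int n * k)"
  by (cases "x = 0"; cases "n = 0")
    (auto simp: ord_ge_def place_power place_1 mult_left_mono)

lemma ord_ge_add: "ord_ge P x k \<Longrightarrow> ord_ge P y k \<Longrightarrow> ord_ge P (x + y) k"
  using place unfolding ord_ge_def places_def by (smt (verit) mem_Collect_eq add_0 add_0_right)

lemma ord_ge_const: "ord_ge P (\<iota> c) 0"
  by (cases "c = 0") (auto simp: ord_ge_def place_const field_embedding_zero[OF emb])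

lemma ord_ge_const_mult: "ord_ge P x k \<Longrightarrow> ord_ge P (\<iota> c * x) k"
  using ord_ge_mult[OF ord_ge_const] by simp

lemma ord_ge_const_iff: "k > 0 \<Longrightarrow> ord_ge P (\<iota> c) k \<longleftrightarrow> c = 0"
  using place_const[of c] field_embedding_eq_0_iff[OF emb, of c] by (auto simp: ord_ge_def)

lemma ord_ge_uminus: "ord_ge P x k \<Longrightarrow> ord_ge P (- x) k"
  using ord_ge_const_mult[of x k "-1"] field_embedding_minus[OF emb, of 1] emb
  by (simp add: field_embedding_def)

lemma ord_ge_diff: "ord_ge P x k \<Longrightarrow> ord_ge P y k \<Longrightarrow> ord_ge P (x - y) k"
  using ord_ge_add[of x k "- y"] ord_ge_uminus by simp

lemma ord_ge_sum: "(\<And>i. i \<in> I \<Longrightarrow> ord_ge P (u i) k) \<Longrightarrow> ord_ge P (sum u I) k"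
  by (induction I rule: infinite_finite_induct) (auto intro: ord_ge_add)

end

section \<open>Residues and power series at a rational place\<close>

locale constants_rational_place = constants_place +
  assumes rational: "rational_place \<iota> P"
begin

text \<open>Degree 1 makes the residue field one-dimensional, spanned by some \<open>b\<close> that
  need not be 1. Writing both 1 and \<open>x\<close> as multiples of \<open>b\<close> and
  eliminating \<open>b\<close> gives the constant \<open>c / d\<close>.\<close>

lemma rational_place_residue:
  assumes "ord_ge P x 0"
  shows "\<exists>c. ord_ge P (x - \<iota> c) 1"
proof -
  define B where "B = (SOME B. residue_basis \<iota> P B)"
  \<comment> \<open>Degree 1 excludes the default value 0, so a basis exists and \<open>B\<close> is
    the one whose size \<open>place_degree\<close> counts.\<close>
  have "\<exists>B. residue_basis \<iota> P B" and card: "card B = 1"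
    using rational by (auto simp: rational_place_def place_degree_def B_def split: if_splits)
  then have B: "residue_basis \<iota> P B"
    unfolding B_def by (metis someI_ex)
  obtain b where b: "B = {b}"
    using card by (auto simp: card_1_singleton_iff)
  have span: "\<exists>c. ord_ge P (z - \<iota> c * b) 1" if "ord_ge P z 0" for z
    using B that unfolding residue_basis_def b by auto
  obtain d where d: "ord_ge P (1 - \<iota> d * b) 1"
    using span[of 1] by (auto simp: ord_ge_def place_1)
  obtain c where c: "ord_ge P (x - \<iota> c * b) 1"
    using span[OF assms] by auto
  have "d \<noteq> 0"
    using d place_1 field_embedding_zero[OF emb] by (auto simp: ord_ge_def)
  then have "\<iota> (c / d) * \<iota> d = \<iota> c"
    using emb by (metis field_embedding_def nonzero_eq_divide_eq)
  then have "x - \<iota> (c / d) = (x - \<iota> c * b) - \<iota> (c / d) * (1 - \<iota> d * b)"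
    by (simp add: right_diff_distrib flip: mult.assoc)
  then show ?thesis
    using ord_ge_diff[OF c ord_ge_const_mult[OF d]] by metis
qed

text \<open>Two admissible constants differ by a constant of positive order, which must be 0; hence
  the description in \<open>place_eval\<close> is well defined.\<close>

lemma place_eval_iff:
  assumes "ord_ge P x 0"
  shows "ord_ge P (x - \<iota> c) 1 \<longleftrightarrow> place_eval \<iota> P x = c"
proof -
  have "\<exists>!c. ord_ge P (x - \<iota> c) 1"
  proof (rule ex_ex1I[OF rational_place_residue[OF assms]])
    fix c d assume "ord_ge P (x - \<iota> c) 1" "ord_ge P (x - \<iota> d) 1"
    then have "ord_ge P (\<iota> (d - c)) 1"
      using ord_ge_diff[of "x - \<iota> c" 1 "x - \<iota> d"]
      by (simp add: field_embedding_diff[OF emb])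
    then show "c = d"
      by (simp add: ord_ge_const_iff)
  qed
  then show ?thesis
    unfolding place_eval_def by (metis (mono_tags, lifting) the_equality)
qed

text \<open>Each coefficient is the residue of the current remainder; subtracting it and dividing by
  \<open>\<phi>\<close> gives the next remainder, again regular. After \<open>N\<close> rounds,
  \<open>x\<close> minus the partial sum is exactly \<open>\<phi> ^ N\<close> times the
  remainder.\<close>

lemma ex_power_series_at_nonneg:
  assumes par: "local_parameter P \<phi>" and x: "ord_ge P x 0"
  shows "\<exists>c. power_series_at \<iota> P \<phi> x c"
proof -
  have \<phi>: "\<phi> \<noteq> 0" "P \<phi> = 1"
    using par by (auto simp: local_parameter_def)
  define step where "step y = (y - \<iota> (place_eval \<iota> P y)) / \<phi>" for y
  define rem where "rem a = (step ^^ a) x" for a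
  define c where "c a = place_eval \<iota> P (rem a)" for a
  have step: "ord_ge P (step y) 0" if "ord_ge P y 0" for y
  proof -
    have "ord_ge P (step y * \<phi>) 1"
      using place_eval_iff[OF that] \<phi> by (auto simp: step_def)
    then show ?thesis
      using \<phi> place_mult[of "step y" \<phi>] by (cases "step y = 0") (auto simp: ord_ge_def)
  qed
  have rem: "ord_ge P (rem a) 0" for a
    by (induction a) (auto simp: rem_def x step)
  have "x - (\<Sum>a<N. \<iota> (c a) * \<phi> ^ a) = \<phi> ^ N * rem N" for N
  proof (induction N)
    case 0
    then show ?case by (simp add: rem_def)
  next
    case (Suc N)
    have "\<phi> * rem (Suc N) = rem N - \<iota> (c N)"
      using \<phi> by (simp add: rem_def step_def c_def)
    then have "\<phi> ^ Suc N * rem (Suc N) = \<phi> ^ N * (rem N - \<iota> (c N))"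
      by (metis mult.assoc power_Suc2)
    with Suc show ?case by (simp add: algebra_simps)
  qed
  moreover have "ord_ge P (\<phi> ^ N * rem N) (int N)" for N
    using ord_ge_mult[OF ord_ge_power[of \<phi> 1 N] rem[of N]] \<phi>
    by (simp add: ord_ge_def)
  ultimately show ?thesis
    unfolding power_series_at_def by metis
qed

text \<open>Division by \<open>\<phi> ^ k\<close> reduces to the regular case; shifting the
  coefficients back fills the first \<open>k\<close> with zeros.\<close>

lemma ex_power_series_at:
  assumes par: "local_parameter P \<phi>" and x: "ord_ge P x (int k)"
  shows "\<exists>c. power_series_at \<iota> P \<phi> x c \<and> (\<forall>a<k. c a = 0)"
proof -
  have \<phi>: "\<phi> \<noteq> 0" "P \<phi> = 1"
    using par by (auto simp: local_parameter_def)
  have xk: "x = \<phi> ^ k * (x / \<phi> ^ k)"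
    using \<phi> by simp
  have "ord_ge P (x / \<phi> ^ k) 0"
    using x xk \<phi> place_mult[of "\<phi> ^ k" "x / \<phi> ^ k"] place_power[of \<phi> k]
    by (cases "x = 0") (auto simp: ord_ge_def)
  then obtain c where c: "power_series_at \<iota> P \<phi> (x / \<phi> ^ k) c"
    using ex_power_series_at_nonneg[OF par] by blast
  define d where "d a = (if a < k then 0 else c (a - k))" for a
  have "ord_ge P (x - (\<Sum>a<N. \<iota> (d a) * \<phi> ^ a)) (int N)" for N
  proof (cases "N \<le> k")
    case True
    then have "(\<Sum>a<N. \<iota> (d a) * \<phi> ^ a) = 0"
      by (intro sum.neutral) (auto simp: d_def field_embedding_zero[OF emb])
    then show ?thesis
      using x True by (auto intro: ord_ge_mono)
  next
    case False
    then obtain M where M: "N = k + M"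
      by (metis less_imp_add_positive not_le)
    have "(\<Sum>a<k + M. \<iota> (d a) * \<phi> ^ a) = (\<Sum>a<M. \<iota> (d (k + a)) * \<phi> ^ (k + a))"
      by (induction M) (simp_all add: d_def field_embedding_zero[OF emb])
    also have "\<dots> = \<phi> ^ k * (\<Sum>a<M. \<iota> (c a) * \<phi> ^ a)"
      by (simp add: d_def sum_distrib_left power_add mult_ac)
    finally have "x - (\<Sum>a<N. \<iota> (d a) * \<phi> ^ a) = \<phi> ^ k * (x / \<phi> ^ k - (\<Sum>a<M. \<iota> (c a) * \<phi> ^ a))"
      using \<phi> by (simp add: M right_diff_distrib)
    moreover have "ord_ge P (\<phi> ^ k * (x / \<phi> ^ k - (\<Sum>a<M. \<iota> (c a) * \<phi> ^ a))) (int k * 1 + int M)"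
      using c \<phi> by (intro ord_ge_mult ord_ge_power)
        (auto simp: power_series_at_def ord_ge_def)
    ultimately show ?thesis
      by (simp add: M)
  qed
  then show ?thesis
    unfolding power_series_at_def by (auto simp: d_def intro!: exI[of _ d])
qed

end

text \<open>The way back from vanishing coefficients to the order: at \<open>N = k\<close> the
  partial sum in the definition is 0.\<close>

lemma power_series_at_ord_ge:
  assumes emb: "field_embedding \<iota>" and series: "power_series_at \<iota> P \<phi> x c"
    and zero: "\<forall>a<k. c a = 0"
  shows "ord_ge P x (int k)"
proof -
  have "(\<Sum>a<k. \<iota> (c a) * \<phi> ^ a) = 0"
    by (intro sum.neutral) (auto simp: zero field_embedding_zero[OF emb])
  then show ?thesis
    using series unfolding power_series_at_def by (metis diff_zero)
qed

section \<open>Divisors and the genus\<close>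

text \<open>Cancellation can shrink the support of a sum of divisors; a common finite index set lets
  degrees be compared termwise.\<close>

lemma divisor_degree_superset:
  assumes "finite S" "Poly_Mapping.keys A \<subseteq> S"
  shows "divisor_degree \<iota> A = (\<Sum>P\<in>S. Poly_Mapping.lookup A P * int (place_degree \<iota> P))"
  unfolding divisor_degree_def using assms
  by (intro sum.mono_neutral_left) (auto simp: in_keys_iff)

lemma divisor_degree_add: "divisor_degree \<iota> (A + B) = divisor_degree \<iota> A + divisor_degree \<iota> B"
proof -
  let ?S = "Poly_Mapping.keys A \<union> Poly_Mapping.keys B"
  have "Poly_Mapping.keys (A + B) \<subseteq> ?S"
    by (rule keys_add)
  then show ?thesis
    by (simp add: divisor_degree_superset[of ?S] lookup_add distrib_right sum.distrib)
qed

lemma divisor_degree_cmul: "divisor_degree \<iota> (frag_cmul k A) = k * divisor_degree \<iota> A"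
  by (simp add: divisor_degree_superset[OF finite_keys keys_cmul]
      divisor_degree_superset[of "Poly_Mapping.keys A" A] sum_distrib_left mult.assoc)

lemma divisor_degree_diff: "divisor_degree \<iota> (A - B) = divisor_degree \<iota> A - divisor_degree \<iota> B"
  using divisor_degree_add[of \<iota> "A - B" B] by simp

lemma divisors_diff: "A \<in> divisors \<iota> \<Longrightarrow> B \<in> divisors \<iota> \<Longrightarrow> A - B \<in> divisors \<iota>"
  using keys_diff[of A B] by (auto simp: divisors_def)

lemma divisors_cmul: "A \<in> divisors \<iota> \<Longrightarrow> frag_cmul k A \<in> divisors \<iota>"
  using keys_cmul[of k A] by (auto simp: divisors_def)

lemma lookup_sum_frag_of:
  "finite S \<Longrightarrow> Poly_Mapping.lookup (sum frag_of S) P = (if P \<in> S then 1 else 0)"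
  by (simp add: lookup_sum)

lemma keys_sum_frag_of: "finite S \<Longrightarrow> Poly_Mapping.keys (sum frag_of S) = S"
  by (auto simp: in_keys_iff lookup_sum_frag_of split: if_splits)

lemma divisor_degree_rational_places:
  assumes "finite S" "\<forall>P\<in>S. rational_place \<iota> P"
  shows "divisor_degree \<iota> (sum frag_of S) = int (card S)"
  using assms by (simp add: divisor_degree_def keys_sum_frag_of lookup_sum_frag_of rational_place_def)

lemma divisors_rational_places:
  assumes "finite S" "\<forall>P\<in>S. rational_place \<iota> P"
  shows "sum frag_of S \<in> divisors \<iota>"
  using assms by (auto simp: divisors_def keys_sum_frag_of rational_place_def)

section \<open>Riemann-Roch spaces\<close>

text \<open>\<open>ord_ge\<close> absorbs the special case \<open>h = 0\<close>, so the closure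
  rules below reduce to rules at each place.\<close>

lemma mem_riemann_roch_space_iff:
  "h \<in> riemann_roch_space \<iota> A \<longleftrightarrow> (\<forall>P\<in>places \<iota>. ord_ge P h (- Poly_Mapping.lookup A P))"
  by (cases "h = 0") (auto simp: riemann_roch_space_def ord_ge_def)

lemma riemann_roch_space_mult:
  assumes "field_embedding \<iota>" "x \<in> riemann_roch_space \<iota> A" "y \<in> riemann_roch_space \<iota> B"
  shows "x * y \<in> riemann_roch_space \<iota> (A + B)"
  using assms(2,3) constants_place.ord_ge_mult[OF constants_place.intro[OF assms(1)]]
  by (fastforce simp: mem_riemann_roch_space_iff lookup_add)

lemma riemann_roch_space_power:
  assumes "field_embedding \<iota>" "x \<in> riemann_roch_space \<iota> A"
  shows "x ^ n \<in> riemann_roch_space \<iota> (frag_cmul (int n) A)"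
  using assms(2) constants_place.ord_ge_power[OF constants_place.intro[OF assms(1)]]
  by (fastforce simp: mem_riemann_roch_space_iff)

lemma riemann_roch_space_diff:
  assumes "field_embedding \<iota>" "x \<in> riemann_roch_space \<iota> A" "y \<in> riemann_roch_space \<iota> A"
  shows "x - y \<in> riemann_roch_space \<iota> A"
  using assms(2,3) constants_place.ord_ge_diff[OF constants_place.intro[OF assms(1)]]
  by (fastforce simp: mem_riemann_roch_space_iff)

lemma riemann_roch_space_mono:
  assumes "x \<in> riemann_roch_space \<iota> A"
    and "\<And>P. P \<in> places \<iota> \<Longrightarrow> Poly_Mapping.lookup A P \<le> Poly_Mapping.lookup B P"
  shows "x \<in> riemann_roch_space \<iota> B"
  using assms by (fastforce simp: mem_riemann_roch_space_iff intro: ord_ge_mono)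

lemma vector_space_over_constants:
  "field_embedding \<iota> \<Longrightarrow> vector_space (\<lambda>c x. \<iota> c * x)"
  by standard (auto simp: field_embedding_def algebra_simps)

section \<open>Existence and vanishing from the genus bound\<close>

context
  fixes \<iota> :: "'k::field \<Rightarrow> 'f::field" and g :: nat
  assumes emb: "field_embedding \<iota>" and genus: "has_genus \<iota> g"
begin

interpretation vs: vector_space "\<lambda>c x. \<iota> c * x"
  using vector_space_over_constants[OF emb] .

lemma rr_dim_ge: "A \<in> divisors \<iota> \<Longrightarrow> int (rr_dim \<iota> A) \<ge> divisor_degree \<iota> A + 1 - int g"
  using genus by (fastforce simp: has_genus_def)

text \<open>Riemann's inequality gives dimension at least \<open>g + 1 - g = 1\<close>, but the zero
  space has dimension 0.\<close>

lemma ex_nonzero_riemann_roch_space: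
  assumes "A \<in> divisors \<iota>" "divisor_degree \<iota> A \<ge> int g"
  shows "\<exists>h\<in>riemann_roch_space \<iota> A. h \<noteq> 0"
proof (rule ccontr)
  assume "\<not> ?thesis"
  then have "riemann_roch_space \<iota> A \<subseteq> vs.span {}"
    by auto
  then have "rr_dim \<iota> A = 0"
    unfolding rr_dim_def using vs.dim_le_card[of _ "{}"] by force
  then show False
    using rr_dim_ge[OF assms(1)] assms(2) by simp
qed

text \<open>
  Infinite-dimensional spaces have \<^const>\<open>rr_dim\<close> zero, so the genus bound also says that
  \<open>L(B)\<close> has finite dimension when \<open>deg B \<ge> g\<close>.  This replaces the usual proof that \<open>L(0)\<close> is
  finite-dimensional, and the degree formula for principal divisors is not needed either: if
  \<open>h \<in> L(A)\<close> is nonzero and \<open>deg A < 0\<close>, then \<open>h\<^sup>m L(-mA) \<subseteq> L(0)\<close> for all \<open>m\<close>, while the dimension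
  of \<open>L(-mA)\<close> is unbounded.
\<close>

lemma riemann_roch_space_degree_neg:
  assumes A: "A \<in> divisors \<iota>" and neg: "divisor_degree \<iota> A < 0"
    and h: "h \<in> riemann_roch_space \<iota> A"
  shows "h = 0"
proof (rule ccontr)
  assume nz: "h \<noteq> 0"
  \<comment> \<open>The negative part of \<open>A\<close>, an effective divisor.\<close>
  define N where "N = Poly_Mapping.map (\<lambda>k. max 0 (- k)) A"
  have lookup_N: "Poly_Mapping.lookup N P = max 0 (- Poly_Mapping.lookup A P)" for P
    by (auto simp: N_def map.rep_eq when_def)
  have "Poly_Mapping.keys N \<subseteq> Poly_Mapping.keys A"
    by (auto simp: in_keys_iff lookup_N)
  then have N: "N \<in> divisors \<iota>"
    using A by (auto simp: divisors_def)
  \<comment> \<open>\<open>N + A\<close> is the positive part of \<open>A\<close>, so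
    \<open>deg N \<ge> - deg A > 0\<close>.\<close>
  have "0 \<le> divisor_degree \<iota> (N + A)"
    unfolding divisor_degree_def by (intro sum_nonneg) (auto simp: lookup_add lookup_N)
  then have "divisor_degree \<iota> N > 0"
    using neg by (simp add: divisor_degree_add)
  then have degN: "divisor_degree \<iota> (frag_cmul (int g) N) \<ge> int g"
    by (simp add: divisor_degree_cmul mult_le_cancel_left1)
  obtain B where B: "vs.independent B" 
      "riemann_roch_space \<iota> (frag_cmul (int g) N) \<subseteq> vs.span B"
      "card B = rr_dim \<iota> (frag_cmul (int g) N)"
    unfolding rr_dim_def by (metis vs.basis_exists)
  \<comment> \<open>An infinite basis would have \<open>card B = 0\<close>, so positive dimension
    forces \<open>L(gN)\<close> to be finite-dimensional.\<close>
  have "card B > 0"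
    using rr_dim_ge[OF divisors_cmul[OF N], of "int g"] degN B(3) by linarith
  then have "finite B"
    by (rule card_ge_0_finite)
  \<comment> \<open>As \<open>deg (- m A) \<ge> m\<close>, this choice gives \<open>L(- m A)\<close>
    dimension at least \<open>m + 1 - g = card B + 1\<close>.\<close>
  define m where "m = card B + g"
  let ?C = "frag_cmul (- int m) A"
  have "divisor_degree \<iota> ?C \<ge> int m"
    using neg by (simp add: divisor_degree_cmul mult_le_cancel_left1 flip: mult_minus_right)
  then have dimC: "rr_dim \<iota> ?C > card B"
    using rr_dim_ge[OF divisors_cmul[OF A], of "- int m"] by (simp add: m_def)
  obtain C where C: "C \<subseteq> riemann_roch_space \<iota> ?C" "vs.independent C" "card C = rr_dim \<iota> ?C"
    unfolding rr_dim_def by (metis vs.basis_exists)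
  let ?f = "\<lambda>x. h ^ m * x"
  interpret lin: Vector_Spaces.linear "\<lambda>c x. \<iota> c * x" "\<lambda>c x. \<iota> c * x" ?f
    by standard (auto simp: algebra_simps)
  have inj: "inj ?f"
    using nz by (auto simp: inj_def)
  have "vs.independent (?f ` C)"
    using C(2) inj by (intro lin.independent_injective_image inj_on_subset[OF inj]) auto
  moreover have "?f ` C \<subseteq> vs.span B"
  proof
    fix y assume "y \<in> ?f ` C"
    then obtain x where x: "x \<in> riemann_roch_space \<iota> ?C" "y = h ^ m * x"
      using C(1) by auto
    \<comment> \<open>The multiples of \<open>A\<close> cancel, so \<open>y\<close> lies in
      \<open>L(0)\<close>, which is contained in \<open>L(gN)\<close> because \<open>N\<close> is
      effective.\<close>
    then have "y \<in> riemann_roch_space \<iota> (frag_cmul (int m) A + ?C)"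
      using riemann_roch_space_mult[OF emb] riemann_roch_space_power[OF emb h] by blast
    then have "y \<in> riemann_roch_space \<iota> (frag_cmul (int g) N)"
      by (rule riemann_roch_space_mono) (simp add: lookup_add lookup_N)
    then show "y \<in> vs.span B"
      using B(2) by auto
  qed
  ultimately have "card (?f ` C) \<le> card B"
    using vs.independent_span_bound[OF \<open>finite B\<close>] by blast
  moreover have "card (?f ` C) = card C"
    by (rule card_image[OF inj_on_subset[OF inj]]) auto
  ultimately show False
    using C(3) dimC by simp
qed

end

section \<open>The decoder\<close>

locale ag_code =
  fixes \<iota> :: "'k::{field,finite} \<Rightarrow> 'f::field" and g :: nat
    and Ps :: "'f place list" and G :: "'f divisor"
  assumes emb: "field_embedding \<iota>" and genus: "has_genus \<iota> g"
    and distinct: "distinct Ps" and rational: "\<forall>P\<in>set Ps. rational_place \<iota> P"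
    and G: "G \<in> divisors \<iota>"
    and disjoint: "Poly_Mapping.keys G \<inter> Poly_Mapping.keys (evaluation_divisor Ps) = {}"
begin

lemma prime_CHAR: "prime CHAR('k)"
  by (simp add: finite_imp_CHAR_pos prime_CHAR_semidom)

lemma prime_CHAR': "prime CHAR('f)"
  using prime_CHAR field_embedding_CHAR[OF emb] by simp

lemma CHAR_power_pos: "CHAR('k) ^ e > 0"
  using prime_gt_0_nat[OF prime_CHAR] by simp

lemma power_CHAR_diff: "(x - y) ^ CHAR('k) ^ e = x ^ CHAR('k) ^ e - (y :: 'f) ^ CHAR('k) ^ e"
  using prime_char_power_diff[OF prime_CHAR'] field_embedding_CHAR[OF emb] by metis

lemma power_CHAR_diff_poly:
  "(x - y) ^ CHAR('k) ^ e = x ^ CHAR('k) ^ e - (y :: 'f poly) ^ CHAR('k) ^ e"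
  using prime_char_power_diff[where ?'a = "'f poly"] prime_CHAR' field_embedding_CHAR[OF emb]
  by (metis semiring_char_poly)

lemma keys_evaluation_divisor: "Poly_Mapping.keys (evaluation_divisor Ps) = set Ps"
  by (simp add: evaluation_divisor_def sum_list_distinct_conv_sum_set distinct keys_sum_frag_of)

lemma lookup_disjoint_eq_0:
  "Poly_Mapping.keys B \<inter> Poly_Mapping.keys (evaluation_divisor Ps) = {} \<Longrightarrow> i < length Ps \<Longrightarrow>
     Poly_Mapping.lookup B (Ps ! i) = 0"
  unfolding keys_evaluation_divisor by (metis disjoint_iff in_keys_iff nth_mem)

lemma constants_rational_place: "i < length Ps \<Longrightarrow> constants_rational_place \<iota> (Ps ! i)"
  using rational emb by unfold_locales (auto simp: rational_place_def)

lemma message_regular: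
  assumes "f \<in> riemann_roch_space \<iota> G" "i < length Ps"
  shows "ord_ge (Ps ! i) f 0"
proof -
  interpret constants_rational_place \<iota> "Ps ! i"
    using constants_rational_place[OF assms(2)] .
  show ?thesis
    using assms(1) place lookup_disjoint_eq_0[OF disjoint assms(2)]
    by (force simp: mem_riemann_roch_space_iff)
qed

lemma codeword_nth_iff:
  assumes "f \<in> riemann_roch_space \<iota> G" "i < length Ps"
  shows "codeword \<iota> Ps f ! i = c \<longleftrightarrow> ord_ge (Ps ! i) (f - \<iota> c) 1"
proof -
  interpret constants_rational_place \<iota> "Ps ! i"
    using constants_rational_place[OF assms(2)] .
  show ?thesis
    using assms place_eval_iff[OF message_regular[OF assms]] by (simp add: codeword_def)
qed

text \<open>Indexing by positions lets agreement and error sets be used directly; distinctness of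
  \<open>Ps\<close> makes the degree the number of positions.\<close>

definition sub_divisor :: "nat set \<Rightarrow> 'f divisor" where
  "sub_divisor I = sum frag_of ((!) Ps ` I)"

lemma lookup_sub_divisor:
  "I \<subseteq> {..<length Ps} \<Longrightarrow>
     Poly_Mapping.lookup (sub_divisor I) P = (if P \<in> (!) Ps ` I then 1 else 0)"
  by (simp add: sub_divisor_def lookup_sum_frag_of finite_subset[OF _ finite_lessThan])

lemma sub_divisor_divisors: "I \<subseteq> {..<length Ps} \<Longrightarrow> sub_divisor I \<in> divisors \<iota>"
  unfolding sub_divisor_def using rational finite_subset[OF _ finite_lessThan]
  by (intro divisors_rational_places) auto

lemma divisor_degree_sub_divisor:
  assumes "I \<subseteq> {..<length Ps}"
  shows "divisor_degree \<iota> (sub_divisor I) = int (card I)"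
proof -
  have "inj_on ((!) Ps) I"
    using assms by (intro inj_on_nth distinct) auto
  then show ?thesis
    unfolding sub_divisor_def using assms rational finite_subset[OF _ finite_lessThan]
    by (subst divisor_degree_rational_places) (auto simp: card_image)
qed

text \<open>Collects local vanishing conditions into one membership. \<open>A\<close> has
  coefficient 0 at the evaluation places, so order \<open>k\<close> there is exactly what the
  subtracted divisor demands.\<close>

lemma riemann_roch_space_diff_sub_divisorI:
  assumes "x \<in> riemann_roch_space \<iota> A" "I \<subseteq> {..<length Ps}"
    and "Poly_Mapping.keys A \<inter> Poly_Mapping.keys (evaluation_divisor Ps) = {}"
    and "\<And>i. i \<in> I \<Longrightarrow> ord_ge (Ps ! i) x k"
  shows "x \<in> riemann_roch_space \<iota> (A - frag_cmul k (sub_divisor I))"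
  unfolding mem_riemann_roch_space_iff
proof
  fix P assume P: "P \<in> places \<iota>"
  show "ord_ge P x (- Poly_Mapping.lookup (A - frag_cmul k (sub_divisor I)) P)"
  proof (cases "P \<in> (!) Ps ` I")
    case True
    then obtain i where "i \<in> I" "P = Ps ! i"
      by blast
    moreover from this have "Poly_Mapping.lookup A P = 0"
      using assms(2,3) lookup_disjoint_eq_0 by auto
    ultimately show ?thesis
      using assms(2,4) by (simp add: lookup_minus lookup_sub_divisor)
  next
    case False
    then show ?thesis
      using assms(1,2) P
      by (simp add: mem_riemann_roch_space_iff lookup_minus lookup_sub_divisor)
  qed
qed

section \<open>Uniqueness of the message within the radius\<close>

lemma card_agreement:
  assumes "length r = length Ps"
  shows "card {i. i < length Ps \<and> codeword \<iota> Ps f ! i = r ! i}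
    + hamming_dist (codeword \<iota> Ps f) r = length Ps"
proof -
  let ?I = "{i. i < length Ps \<and> codeword \<iota> Ps f ! i = r ! i}"
  let ?E = "{i. i < length Ps \<and> codeword \<iota> Ps f ! i \<noteq> r ! i}"
  have "card ?I + card ?E = card (?I \<union> ?E)"
    by (rule card_Un_disjoint[symmetric]) auto
  also have "?I \<union> ?E = {..<length Ps}"
    by auto
  finally show ?thesis
    by (simp add: hamming_dist_def codeword_def)
qed

text \<open>Both codewords agree with \<open>r\<close> on at least \<open>n - 2 \<tau>\<close>
  common positions. There \<open>f - f'\<close> vanishes, so it lies in a Riemann-Roch space of
  degree at most \<open>2 \<tau>\<close> minus the designed distance, which is negative.\<close>

lemma message_unique:
  assumes r: "length r = length Ps"
    and f: "f \<in> riemann_roch_space \<iota> G" "hamming_dist (codeword \<iota> Ps f) r \<le> \<tau>"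
    and f': "f' \<in> riemann_roch_space \<iota> G" "hamming_dist (codeword \<iota> Ps f') r \<le> \<tau>"
    and \<tau>: "2 * int \<tau> < designed_distance \<iota> Ps G"
  shows "f = f'"
proof -
  define agree where "agree f = {i. i < length Ps \<and> codeword \<iota> Ps f ! i = r ! i}" for f
  let ?I = "agree f \<inter> agree f'"
  have I: "?I \<subseteq> {..<length Ps}"
    by (auto simp: agree_def)
  have fin: "finite (agree f)" "finite (agree f')"
    by (auto simp: agree_def)
  have "card (agree f \<union> agree f') \<le> card {..<length Ps}"
    by (rule card_mono) (auto simp: agree_def)
  then have "length Ps \<le> card ?I + 2 * \<tau>"
    using card_Un_Int[OF fin] card_agreement[OF r, of f] card_agreement[OF r, of f'] f(2) f'(2)
    unfolding agree_def by simp
  then have "divisor_degree \<iota> (G - frag_cmul 1 (sub_divisor ?I)) < 0"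
    using \<tau> I by (simp add: divisor_degree_diff divisor_degree_sub_divisor designed_distance_def)
  moreover have "f - f' \<in> riemann_roch_space \<iota> (G - frag_cmul 1 (sub_divisor ?I))"
  proof (rule riemann_roch_space_diff_sub_divisorI[OF _ I disjoint])
    show "f - f' \<in> riemann_roch_space \<iota> G"
      using riemann_roch_space_diff[OF emb f(1) f'(1)] .
  next
    fix i assume i: "i \<in> ?I"
    then have len: "i < length Ps"
      by (auto simp: agree_def)
    interpret constants_rational_place \<iota> "Ps ! i"
      using constants_rational_place[OF len] .
    have "ord_ge (Ps ! i) (f - \<iota> (r ! i)) 1" "ord_ge (Ps ! i) (f' - \<iota> (r ! i)) 1"
      using i codeword_nth_iff[OF f(1) len] codeword_nth_iff[OF f'(1) len]
      by (auto simp: agree_def)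
    then show "ord_ge (Ps ! i) (f - f') 1"
      using ord_ge_diff[of "f - \<iota> (r ! i)" 1 "f' - \<iota> (r ! i)"] by simp
  qed
  ultimately have "f - f' = 0"
    using riemann_roch_space_degree_neg[OF emb genus]
      divisors_diff[OF G divisors_cmul[OF sub_divisor_divisors[OF I]]] by blast
  then show ?thesis
    by simp
qed

section \<open>Interpolation polynomials: roots and existence\<close>

text \<open>The coefficient of \<open>(z - c) ^ b\<close> has order at least \<open>m - b\<close>,
  and \<open>f - c\<close>, being of positive order, supplies the missing \<open>b\<close>.\<close>

lemma zero_of_mult_ge_poly:
  assumes zero: "zero_of_mult_ge \<iota> (Ps ! i) c Q m" and i: "i < length Ps"
    and f: "ord_ge (Ps ! i) (f - \<iota> c) 1"
  shows "ord_ge (Ps ! i) (poly Q f) (int m)"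
proof -
  interpret constants_rational_place \<iota> "Ps ! i"
    using constants_rational_place[OF i] .
  obtain \<phi> h s where Q: "Q = (\<Sum>b\<le>degree Q. smult (h b) ([:- \<iota> c, 1:] ^ b))"
    and series: "\<forall>b\<le>degree Q. power_series_at \<iota> (Ps ! i) \<phi> (h b) (\<lambda>a. s a b)"
    and s: "\<forall>a b. a + b < m \<longrightarrow> s a b = 0"
    using zero by (auto simp: zero_of_mult_ge_def)
  have "poly Q f = (\<Sum>b\<le>degree Q. h b * (f - \<iota> c) ^ b)"
    by (subst Q) (simp add: poly_sum)
  also have "ord_ge (Ps ! i) \<dots> (int m)"
  proof (rule ord_ge_sum)
    fix b assume "b \<in> {..degree Q}"
    then have "ord_ge (Ps ! i) (h b) (int (m - b))"
      using series s by (intro power_series_at_ord_ge[OF emb, of _ \<phi> _ "\<lambda>a. s a b"]) auto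
    then have "ord_ge (Ps ! i) (h b * (f - \<iota> c) ^ b) (int (m - b) + int b * 1)"
      by (intro ord_ge_mult ord_ge_power f)
    \<comment> \<open>Subtraction is truncated: for \<open>b > m\<close> the order obtained is
      \<open>b\<close>, which exceeds \<open>m\<close>.\<close>
    then show "ord_ge (Ps ! i) (h b * (f - \<iota> c) ^ b) (int m)"
      by (rule ord_ge_mono) simp
  qed
  finally show ?thesis .
qed

lemma interpolation_poly_root:
  assumes A: "decoder_divisor \<iota> Ps e \<tau> A" and Q: "interpolation_poly \<iota> Ps G e A r Q"
    and r: "length r = length Ps"
    and f: "f \<in> riemann_roch_space \<iota> G" "hamming_dist (codeword \<iota> Ps f) r \<le> \<tau>"
  shows "poly Q f = 0"
proof -
  let ?q = "CHAR('k) ^ e"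
  define I where "I = {i. i < length Ps \<and> codeword \<iota> Ps f ! i = r ! i}"
  have I: "I \<subseteq> {..<length Ps}"
    by (auto simp: I_def)
  obtain Q0 Q1 where Q0: "Q0 \<in> riemann_roch_space \<iota> A"
    and Q1: "Q1 \<in> riemann_roch_space \<iota> (A - frag_cmul (int ?q) G)"
    and Q_eq: "Q = monom Q1 ?q + [:Q0:]"
    and zero: "\<And>i. i < length Ps \<Longrightarrow> zero_of_mult_ge \<iota> (Ps ! i) (r ! i) Q ?q"
    using Q by (auto simp: interpolation_poly_def)
  have "Q1 * f ^ ?q \<in> riemann_roch_space \<iota> A"
    using riemann_roch_space_mult[OF emb Q1 riemann_roch_space_power[OF emb f(1), of ?q]] by simp
  moreover have "0 - Q0 \<in> riemann_roch_space \<iota> A"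
    by (rule riemann_roch_space_diff[OF emb _ Q0]) (simp add: riemann_roch_space_def)
  ultimately have "poly Q f \<in> riemann_roch_space \<iota> A"
    using riemann_roch_space_diff[OF emb, of "Q1 * f ^ ?q" A "0 - Q0"] by (simp add: Q_eq poly_monom)
  then have "poly Q f \<in> riemann_roch_space \<iota> (A - frag_cmul (int ?q) (sub_divisor I))"
    using A zero codeword_nth_iff[OF f(1)] unfolding I_def decoder_divisor_def
    by (intro riemann_roch_space_diff_sub_divisorI zero_of_mult_ge_poly) auto
  moreover have "A - frag_cmul (int ?q) (sub_divisor I) \<in> divisors \<iota>"
    using A unfolding decoder_divisor_def
    by (intro divisors_diff divisors_cmul sub_divisor_divisors[OF I]) auto
  \<comment> \<open>At least \<open>n - \<tau>\<close> positions agree, each lowering the degree by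
    \<open>q\<close>; the \<open>- 1\<close> in the degree of \<open>A\<close> makes the result
    strictly negative.\<close>
  moreover have "divisor_degree \<iota> (A - frag_cmul (int ?q) (sub_divisor I)) < 0"
  proof -
    have "int (length Ps) - int \<tau> \<le> int (card I)"
      using card_agreement[OF r, of f] f(2) by (simp add: I_def)
    then have "int ?q * (int (length Ps) - int \<tau>) \<le> int ?q * int (card I)"
      by (rule mult_left_mono) simp
    then show ?thesis
      using A I by (simp add: decoder_divisor_def divisor_degree_diff divisor_degree_cmul
          divisor_degree_sub_divisor del: of_nat_power)
  qed
  ultimately show ?thesis
    using riemann_roch_space_degree_neg[OF emb genus] by blast
qed

text \<open>
  In characteristic \<open>p\<close>, \<open>z\<^sup>q - f\<^sup>q = (z - r)\<^sup>q - (f - r)\<^sup>q\<close> for \<open>q = p\<^sup>e\<close>, so \<open>Q\<^sub>1 (z\<^sup>q - f\<^sup>q)\<close> has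
  the two coefficients \<open>- Q\<^sub>1 (f - r)\<^sup>q\<close> and \<open>Q\<^sub>1\<close> at \<open>z - r\<close>.
\<close>

lemma zero_of_mult_ge_linearized:
  assumes i: "i < length Ps" and nz: "Q1 \<noteq> 0"
    and Q1: "ord_ge (Ps ! i) Q1 0"
    and prod: "ord_ge (Ps ! i) (Q1 * (f - \<iota> c) ^ CHAR('k) ^ e) (int (CHAR('k) ^ e))"
  shows "zero_of_mult_ge \<iota> (Ps ! i) c
    (monom Q1 (CHAR('k) ^ e) + [:- (Q1 * f ^ CHAR('k) ^ e):]) (CHAR('k) ^ e)"
proof -
  define q where "q = CHAR('k) ^ e"
  interpret constants_rational_place \<iota> "Ps ! i"
    using constants_rational_place[OF i] .
  let ?Q = "monom Q1 q + [:- (Q1 * f ^ q):]"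
  have "q > 0"
    unfolding q_def by (rule CHAR_power_pos)
  \<comment> \<open>The multiplicity condition sums up to the degree of the polynomial, so the exact
    degree is needed.\<close>
  then have deg: "degree ?Q = q"
    using nz by (simp add: degree_add_eq_left degree_monom_eq)
  define h where "h b = (if b = q then Q1 else if b = 0 then - (Q1 * (f - \<iota> c) ^ q) else 0)" for b
  have "[:- \<iota> c, 1:] ^ q = ([:0, 1:] - [:\<iota> c:]) ^ q"
    by simp
  also have "\<dots> = [:0, 1:] ^ q - [:\<iota> c:] ^ q"
    unfolding q_def by (rule power_CHAR_diff_poly)
  also have "\<dots> = monom 1 q - [:\<iota> c ^ q:]"
    by (simp add: monom_altdef poly_const_pow)
  finally have lin: "[:- \<iota> c, 1:] ^ q = monom 1 q - [:\<iota> c ^ q:]" .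
  have "(\<Sum>b\<le>q. smult (h b) ([:- \<iota> c, 1:] ^ b)) = (\<Sum>b\<in>{0, q}. smult (h b) ([:- \<iota> c, 1:] ^ b))"
    by (rule sum.mono_neutral_right) (auto simp: h_def)
  also have "\<dots> = [:- (Q1 * (f ^ q - \<iota> c ^ q)):] + smult Q1 (monom 1 q - [:\<iota> c ^ q:])"
    using \<open>q > 0\<close> power_CHAR_diff[of f "\<iota> c" e] by (simp add: h_def lin flip: q_def)
  also have "\<dots> = ?Q"
    by (simp add: smult_diff_right smult_monom algebra_simps)
  finally have expansion: "?Q = (\<Sum>b\<le>degree ?Q. smult (h b) ([:- \<iota> c, 1:] ^ b))"
    by (simp add: deg)
  obtain \<phi> where \<phi>: "local_parameter (Ps ! i) \<phi>"
    using place by (auto simp: places_def local_parameter_def)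
  \<comment> \<open>The required order is 0 at \<open>b = q\<close>, met by \<open>Q1\<close>, and
    \<open>q\<close> at \<open>b = 0\<close>, met by \<open>prod\<close>; the other coefficients are
    0.\<close>
  have "ord_ge (Ps ! i) (h b) (int (q - b))" for b
    using Q1 ord_ge_uminus[OF prod] by (auto simp: h_def q_def)
  then have "\<forall>b. \<exists>s. power_series_at \<iota> (Ps ! i) \<phi> (h b) s \<and> (\<forall>a<q - b. s a = 0)"
    using ex_power_series_at[OF \<phi>] by blast
  then obtain s where s: "\<And>b. power_series_at \<iota> (Ps ! i) \<phi> (h b) (s b) \<and> (\<forall>a<q - b. s b a = 0)"
    unfolding choice_iff by blast
  show ?thesis
    unfolding zero_of_mult_ge_def q_def[symmetric]
    by (rule exI[of _ \<phi>], rule exI[of _ h], rule exI[of _ "\<lambda>a b. s b a"])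
      (use \<phi> expansion s in \<open>auto simp: less_diff_conv\<close>)
qed

text \<open>The order \<open>q\<close> of \<open>Q1 (f - r) ^ q\<close> comes from \<open>Q1\<close>
  at places in error and from \<open>f - r\<close> at all others.\<close>

lemma interpolation_poly_exists:
  assumes A: "decoder_divisor \<iota> Ps e \<tau> A"
    and f: "f \<in> riemann_roch_space \<iota> G" "hamming_dist (codeword \<iota> Ps f) r \<le> \<tau>"
    and \<tau>: "int (CHAR('k) ^ e) * (designed_distance \<iota> Ps G - 2 * int \<tau>) \<ge> 1 + int g"
  shows "\<exists>Q. interpolation_poly \<iota> Ps G e A r Q"
proof -
  define q where "q = CHAR('k) ^ e"
  have A': "A \<in> divisors \<iota>"
    and disjA: "Poly_Mapping.keys A \<inter> Poly_Mapping.keys (evaluation_divisor Ps) = {}"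
    and degA: "divisor_degree \<iota> A = int q * (int (length Ps) - int \<tau>) - 1"
    using A by (auto simp: decoder_divisor_def q_def)
  define E where "E = {i. i < length Ps \<and> codeword \<iota> Ps f ! i \<noteq> r ! i}"
  have E: "E \<subseteq> {..<length Ps}"
    by (auto simp: E_def)
  let ?B = "A - frag_cmul (int q) G"
  let ?C = "?B - frag_cmul (int q) (sub_divisor E)"
  have "card E \<le> \<tau>"
    using f(2) by (simp add: E_def hamming_dist_def codeword_def)
  then have "int q * int (card E) \<le> int q * int \<tau>"
    by (intro mult_left_mono) auto
  then have "divisor_degree \<iota> ?C \<ge> int g"
    using \<tau> degA E unfolding q_def[symmetric] designed_distance_def
    by (simp add: divisor_degree_diff divisor_degree_cmul divisor_degree_sub_divisor divisor_degree_add algebra_simps)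
  moreover have "?C \<in> divisors \<iota>"
    by (intro divisors_diff divisors_cmul sub_divisor_divisors A' G E)
  ultimately obtain Q1 where Q1: "Q1 \<in> riemann_roch_space \<iota> ?C" "Q1 \<noteq> 0"
    using ex_nonzero_riemann_roch_space[OF emb genus] by blast
  let ?R = "- (Q1 * f ^ q)"
  let ?Q = "monom Q1 q + [:?R:]"
  have Q1B: "Q1 \<in> riemann_roch_space \<iota> ?B"
    by (rule riemann_roch_space_mono[OF Q1(1)]) (simp add: lookup_minus lookup_sub_divisor[OF E])
  have "Q1 * f ^ q \<in> riemann_roch_space \<iota> A"
    using riemann_roch_space_mult[OF emb Q1B riemann_roch_space_power[OF emb f(1), of q]] by simp
  then have Q0: "?R \<in> riemann_roch_space \<iota> A"
    using riemann_roch_space_diff[OF emb, of 0 A "Q1 * f ^ q"] by (simp add: riemann_roch_space_def)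
  \<comment> \<open>Since \<open>q > 0\<close>, the constant term does not meet the coefficient at
    \<open>q\<close>.\<close>
  have "coeff ?Q q = Q1"
    using CHAR_power_pos[of e] by (cases q) (auto simp: q_def)
  then have nz: "?Q \<noteq> 0"
    using Q1(2) by (metis coeff_0)
  have "zero_of_mult_ge \<iota> (Ps ! i) (r ! i) ?Q q" if i: "i < length Ps" for i
  proof -
    interpret constants_rational_place \<iota> "Ps ! i"
      using constants_rational_place[OF i] .
    \<comment> \<open>By distinctness, a correct position never shares its place with an erroneous
      one.\<close>
    have "i \<in> E \<longleftrightarrow> Ps ! i \<in> (!) Ps ` E"
      using i E distinct by (auto simp: nth_eq_iff_index_eq subset_iff)
    then have lookup_C: "- Poly_Mapping.lookup ?C (Ps ! i) = (if i \<in> E then int q else 0)"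
      using lookup_disjoint_eq_0[OF disjA i] lookup_disjoint_eq_0[OF disjoint i]
      by (simp add: lookup_minus lookup_sub_divisor[OF E])
    have ordQ1: "ord_ge (Ps ! i) Q1 (if i \<in> E then int q else 0)"
      using bspec[OF Q1(1)[unfolded mem_riemann_roch_space_iff] place] unfolding lookup_C .
    have "ord_ge (Ps ! i) (f - \<iota> (r ! i)) (if i \<in> E then 0 else 1)"
      using codeword_nth_iff[OF f(1) i] i ord_ge_diff[OF message_regular[OF f(1) i] ord_ge_const]
      by (auto simp: E_def)
    then have "ord_ge (Ps ! i) (Q1 * (f - \<iota> (r ! i)) ^ q)
        ((if i \<in> E then int q else 0) + int q * (if i \<in> E then 0 else 1))"
      by (intro ord_ge_mult ord_ge_power ordQ1)
    moreover have "ord_ge (Ps ! i) Q1 0"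
      using ordQ1 by (rule ord_ge_mono) simp
    ultimately show ?thesis
      using zero_of_mult_ge_linearized[OF i Q1(2), of f "r ! i" e]
      by (simp add: q_def split: if_splits)
  qed
  then show ?thesis
    using nz Q0 Q1B unfolding interpolation_poly_def q_def by blast
qed

section \<open>The decoding radius\<close>

text \<open>An upper bound on \<open>X\<close>, rather than a fixed value, covers both radii of the
  final statement.\<close>

lemma bounded_distance_decoder_gs_decoder:
  assumes X: "X \<le> real_of_int (designed_distance \<iota> Ps G) / 2
    - (1 + real g) / (2 * real (CHAR('k) ^ e))"
  shows "bounded_distance_decoder \<iota> Ps G (gs_decoder \<iota> Ps G e) X"
  unfolding bounded_distance_decoder_def Let_def
proof (intro allI impI)
  fix \<tau> and r :: "'k list" assume \<tau>: "real \<tau> \<le> X" and r: "length r = length Ps"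
  define q where "q = CHAR('k) ^ e"
  have "q > 0"
    unfolding q_def by (rule CHAR_power_pos)
  let ?d = "designed_distance \<iota> Ps G"
  define S where "S = {f \<in> riemann_roch_space \<iota> G. hamming_dist (codeword \<iota> Ps f) r \<le> \<tau>}"
  have "(1 + real g) / (2 * real q) \<le> (real_of_int ?d - 2 * real \<tau>) / 2"
    using \<tau> X unfolding q_def by (simp add: field_simps)
  then have "1 + real g \<le> real q * (real_of_int ?d - 2 * real \<tau>)"
    using \<open>q > 0\<close> by (simp add: field_simps)
  also have "\<dots> = real_of_int (int q * (?d - 2 * int \<tau>))"
    by simp
  \<comment> \<open>This serves twice: in full for the existence of an interpolation polynomial, and
    as mere positivity for uniqueness.\<close>
  finally have bound: "1 + int g \<le> int q * (?d - 2 * int \<tau>)"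
    by linarith
  then have "0 < int q * (?d - 2 * int \<tau>)"
    by linarith
  then have "2 * int \<tau> < ?d"
    by (simp add: zero_less_mult_iff)
  then have unique: "\<forall>f\<in>S. \<forall>f'\<in>S. f = f'"
    unfolding S_def using message_unique[OF r] by blast
  have result: "(\<forall>f\<in>S. res = Some f) \<and> (S = {} \<longrightarrow> res = None)"
    if dec: "gs_decoder \<iota> Ps G e \<tau> r res" for res
  proof -
    obtain A where A: "decoder_divisor \<iota> Ps e \<tau> A"
      and res: "if \<exists>Q. interpolation_poly \<iota> Ps G e A r Q
        then \<exists>Q. interpolation_poly \<iota> Ps G e A r Q \<and>
          (let S = {f \<in> riemann_roch_space \<iota> G.
                      poly Q f = 0 \<and> hamming_dist (codeword \<iota> Ps f) r \<le> \<tau>}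
           in if S = {} then res = None else (\<exists>f\<in>S. res = Some f))
        else res = None"
      using dec unfolding gs_decoder_def by blast
    \<comment> \<open>All of \<open>S\<close> consists of roots of every admissible
      \<open>Q\<close>, so the root test discards nothing and the choice of \<open>Q\<close> does
      not affect the result.\<close>
    have roots: "{f \<in> riemann_roch_space \<iota> G.
        poly Q f = 0 \<and> hamming_dist (codeword \<iota> Ps f) r \<le> \<tau>} = S"
      if "interpolation_poly \<iota> Ps G e A r Q" for Q
      unfolding S_def using interpolation_poly_root[OF A that r] by blast
    show ?thesis
    proof (cases "\<exists>Q. interpolation_poly \<iota> Ps G e A r Q")
      case True
      with res obtain Q where Q: "interpolation_poly \<iota> Ps G e A r Q"
        and found: "let S = {f \<in> riemann_roch_space \<iota> G.
                      poly Q f = 0 \<and> hamming_dist (codeword \<iota> Ps f) r \<le> \<tau>}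
           in if S = {} then res = None else (\<exists>f\<in>S. res = Some f)"
        by auto
      have "if S = {} then res = None else (\<exists>f\<in>S. res = Some f)"
        using found unfolding Let_def roots[OF Q] .
      then show ?thesis
        using unique by (auto split: if_splits)
    next
      case False
      \<comment> \<open>Any message in \<open>S\<close> would yield an interpolation polynomial, so
        declaring failure is correct here.\<close>
      then have "S = {}"
        unfolding S_def using interpolation_poly_exists[OF A] bound unfolding q_def by blast
      then show ?thesis
        using False res by simp
    qed
  qed
  show "(\<forall>f\<in>{f \<in> riemann_roch_space \<iota> G. hamming_dist (codeword \<iota> Ps f) r \<le> \<tau>}.
        \<forall>f'\<in>{f \<in> riemann_roch_space \<iota> G. hamming_dist (codeword \<iota> Ps f) r \<le> \<tau>}. f = f') \<and>
      (\<forall>res. gs_decoder \<iota> Ps G e \<tau> r res \<longrightarrow>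
        (\<forall>f\<in>{f \<in> riemann_roch_space \<iota> G. hamming_dist (codeword \<iota> Ps f) r \<le> \<tau>}. res = Some f) \<and>
        ({f \<in> riemann_roch_space \<iota> G. hamming_dist (codeword \<iota> Ps f) r \<le> \<tau>} = {} \<longrightarrow> res = None))"
    unfolding S_def[symmetric] by (intro conjI[OF unique] allI impI result)
qed

end

theorem corollary8:
  fixes \<iota> :: "'k::{field,finite} \<Rightarrow> 'f::field"
    and g e :: nat
    and Ps :: "'f place list"
    and G :: "'f divisor"
  assumes "function_field \<iota>"
    and "full_constant_field \<iota>"
    and "has_genus \<iota> g"
    and "distinct Ps"
    and "\<forall>P\<in>set Ps. rational_place \<iota> P"
    and "G \<in> divisors \<iota>"
    and "Poly_Mapping.keys G \<inter> Poly_Mapping.keys (evaluation_divisor Ps) = {}"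
  shows "bounded_distance_decoder \<iota> Ps G (gs_decoder \<iota> Ps G e)
           (real_of_int (designed_distance \<iota> Ps G) / 2
              - (1 + real g) / (2 * real (CHAR('k) ^ e)))
       \<and> bounded_distance_decoder \<iota> Ps G
           (gs_decoder \<iota> Ps G (nat \<lceil>log (real CHAR('k)) (1 + real g)\<rceil>))
           ((real_of_int (designed_distance \<iota> Ps G) - 1) / 2)"
proof -
  interpret ag_code \<iota> g Ps G
    using assms by unfold_locales (auto simp: function_field_def)
  define p where "p = real CHAR('k)"
  define e' where "e' = nat \<lceil>log p (1 + real g)\<rceil>"
  have p: "p > 1"
    using prime_gt_1_nat[OF prime_CHAR] by (simp add: p_def)
  have "log p (1 + real g) \<le> real e'"
    unfolding e'_def by linarith
  then have "1 + real g \<le> p ^ e'"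
    using p by (simp add: log_le_iff powr_realpow)
  \<comment> \<open>The exponent is chosen so that the genus term costs at most
    \<open>1 / 2\<close>.\<close>
  then have "(1 + real g) / (2 * real (CHAR('k) ^ e')) \<le> 1 / 2"
    using p by (simp add: p_def field_simps)
  then have "(real_of_int (designed_distance \<iota> Ps G) - 1) / 2 \<le>
      real_of_int (designed_distance \<iota> Ps G) / 2 - (1 + real g) / (2 * real (CHAR('k) ^ e'))"
    by (simp add: diff_divide_distrib)
  then show ?thesis
    using bounded_distance_decoder_gs_decoder unfolding e'_def p_def by blast
qed

end
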